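(* Let $n\in\mathbb{N}$ and let $K\subseteq\mathbb{R}^n$ be a symmetric convex body. Suppose that $f\colon[0,\infty)\to[0,\infty)$ is a continuous function with $\int_{\mathbb{R}^n} f(\|x\|_K)\,dx=1$, and that $Z$ is a random vector in $\mathbb{R}^n$ whose distribution is given by $$\mathbf{P}(Z\in A)=\int_A f(\|x\|_K)\,dx\qquad\text{for every Borel set }A\subseteq\mathbb{R}^n .$$ Let $U$ be a random variable uniformly distributed on $[0,1]$ and independent of $Z$. Then $$\frac{Z}{\|Z\|_K}\sim\mu_K\qquad\text{and}\qquad U^{1/n}\,\frac{Z}{\|Z\|_K}\sim\nu_K .$$ In addition, $Z/\|Z\|_K$ is independent of $\|Z\|_K$.
   Context: A convex body in $\mathbb{R}^n$ is a compact convex set with non-empty interior; it is symmetric if $x\in K$ implies $-x\in K$. The Minkowski functional of $K$ is $\|x\|_K:=\inf\{r>0: x\in rK\}$, $x\in\mathbb{R}^n$; it is a norm. $|A|$ denotes the $n$-dimensional Lebesgue measure of $A$, and for $I\subseteq[0,\infty)$ and $B\subseteq\mathbb{R}^n$ we write $IB:=\{rx: r\in I,\ x\in B\}$. The uniform probability measure on $K$ is $\nu_K(A):=|A\cap K|/|K|$ for Borel $A\subseteq\mathbb{R}^n$. The cone probability measure on the boundary $\partial K$ is $\mu_K(B):=|[0,1]B|/|K|$ for Borel $B\subseteq\partial K$. $X\sim Q$ means that the random vector $X$ has distribution $Q$. *)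

theory Defs
  imports "HOL-Probability.Probability"
begin

definition symmetric_convex_body :: "'a::euclidean_space set \<Rightarrow> bool" where
  "symmetric_convex_body K \<longleftrightarrow>
     compact K \<and> convex K \<and> interior K \<noteq> {} \<and> (\<forall>x\<in>K. - x \<in> K)"

definition minkowski_functional :: "'a::euclidean_space set \<Rightarrow> 'a \<Rightarrow> real" where
  "minkowski_functional K x = Inf {r. r > 0 \<and> x \<in> (*\<^sub>R) r ` K}"

definition dilates :: "real set \<Rightarrow> 'a::euclidean_space set \<Rightarrow> 'a set" where
  "dilates I B = {r *\<^sub>R x | r x. r \<in> I \<and> x \<in> B}"

text \<open>
  The cone measure lives on the boundary, with the Borel subsets of the boundary as its
  sigma-algebra. For a symmetric convex body the set function below is countably additive
  (dilates of disjoint sets meet at most in the origin, a null set), so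
  \<^const>\<open>measure_of\<close> does not fall back to the zero measure.
\<close>
definition cone_measure :: "'a::euclidean_space set \<Rightarrow> 'a measure" where
  "cone_measure K =
     measure_of (frontier K) (sets (restrict_space borel (frontier K)))
       (\<lambda>B. emeasure lborel (dilates {0..1} B) / emeasure lborel K)"

text \<open>
  \<open>has_law M X Q\<close> is X ~ Q for a random vector X on M. The law Q may live on a Borel
  subset of the ambient space (as \<^const>\<open>cone_measure\<close> does); it is then compared with the
  law of X after being pushed forward along the inclusion.
\<close>
definition has_law :: "'m measure \<Rightarrow> ('m \<Rightarrow> 'a::euclidean_space) \<Rightarrow> 'a measure \<Rightarrow> bool" where
  "has_law M X Q \<longleftrightarrow>
     X \<in> borel_measurable M \<and> distr M borel X = distr Q borel (\<lambda>x. x)"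

text \<open>
  The library's \<open>indep_var\<close> requires both variables to have the same value type. This is
  its definition for two value types: independence of the generated sigma-algebras.
\<close>
definition indep_rvs ::
    "'m measure \<Rightarrow> 'a measure \<Rightarrow> ('m \<Rightarrow> 'a) \<Rightarrow> 'b measure \<Rightarrow> ('m \<Rightarrow> 'b) \<Rightarrow> bool" where
  "indep_rvs M S X T Y \<longleftrightarrow>
     X \<in> measurable M S \<and> Y \<in> measurable M T \<and>
     prob_space.indep_set M
       {X -` A \<inter> space M | A. A \<in> sets S}
       {Y -` B \<inter> space M | B. B \<in> sets T}"

end

theory Submission
  imports Defs
begin

text \<open>
  The proof rests on the scaling of Lebesgue measure. Write \<open>|x|\<close> for the Minkowski functional and
  \<open>x/|x|\<close> for the direction. For \<open>a > 0\<close>, the set \<open>{x. x/|x| \<in> A \<and> |x| \<le> a}\<close> is the \<open>a\<close>-dilate of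
  \<open>{x \<in> K. x/|x| \<in> A}\<close>, so its volume is \<open>a\<close> to the power of the dimension times a number depending
  on \<open>A\<close> only. Hence, under Lebesgue measure, direction and norm factorize as if they were
  independent (\<open>emeasure_cone_factor\<close>), and integration extends this from the indicator functions of
  initial segments to every Borel function of the norm (\<open>nn_integral_cone_factor\<close>). The factor
  belonging to the direction is the law of \<open>X/|X|\<close> for \<open>X\<close> uniform on \<open>K\<close>. Up to the origin, the
  points of \<open>K\<close> with direction in \<open>B\<close> form the cone over \<open>B\<close>, so this law is the cone measure
  (\<open>cone_measure_eq\<close>, \<open>distr_cone_measure\<close>).

  If \<open>Z\<close> has a density that depends on the norm only, the factorization says that \<open>Z/|Z|\<close> follows the
  cone measure and is independent of \<open>|Z|\<close> (\<open>distr_direction\<close>, \<open>indep_direction_norm\<close>). The uniform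
  vector \<open>X\<close> is itself of this kind, and \<open>|X|\<close> has the law of \<open>U\<close> to the power of one over the
  dimension (\<open>distr_norm_uniform_law\<close>). So that power of \<open>U\<close> together with \<open>Z/|Z|\<close> has the same joint
  law as \<open>|X|\<close> together with \<open>X/|X|\<close>, both being product laws with equal marginals, and multiplying
  the two components gives the law of \<open>X\<close> (\<open>distr_radius_direction\<close>).
\<close>

section \<open>Independence of two random variables and uniqueness of laws\<close>

text \<open>
  The product rule in terms of \<^const>\<open>emeasure\<close>, where it can be compared with integrals directly.
\<close>

lemma indep_rvs_iff:
  assumes "prob_space M"
  shows "indep_rvs M S X T Y \<longleftrightarrow> X \<in> measurable M S \<and> Y \<in> measurable M T \<and>
    (\<forall>A\<in>sets S. \<forall>B\<in>sets T. emeasure M {\<omega> \<in> space M. X \<omega> \<in> A \<and> Y \<omega> \<in> B} =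
       emeasure M {\<omega> \<in> space M. X \<omega> \<in> A} * emeasure M {\<omega> \<in> space M. Y \<omega> \<in> B})"
proof -
  interpret prob_space M by fact
  have vim: "X -` A \<inter> space M = {\<omega> \<in> space M. X \<omega> \<in> A}"
    "Y -` B \<inter> space M = {\<omega> \<in> space M. Y \<omega> \<in> B}" for A B by auto
  have inter: "{\<omega> \<in> space M. X \<omega> \<in> A} \<inter> {\<omega> \<in> space M. Y \<omega> \<in> B} =
     {\<omega> \<in> space M. X \<omega> \<in> A \<and> Y \<omega> \<in> B}" for A B by auto
  have em: "(emeasure M a = emeasure M b * emeasure M c) \<longleftrightarrow> prob a = prob b * prob c" for a b c
    by (simp add: emeasure_eq_measure flip: ennreal_mult)
  show ?thesis
    unfolding indep_rvs_def vim em
  proof (intro conj_cong refl iffI ballI)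
    fix A B assume "A \<in> sets S" "B \<in> sets T"
      "indep_set {{\<omega> \<in> space M. X \<omega> \<in> A} |A. A \<in> sets S} {{\<omega> \<in> space M. Y \<omega> \<in> B} |B. B \<in> sets T}"
    then show "prob {\<omega> \<in> space M. X \<omega> \<in> A \<and> Y \<omega> \<in> B} =
        prob {\<omega> \<in> space M. X \<omega> \<in> A} * prob {\<omega> \<in> space M. Y \<omega> \<in> B}"
      unfolding inter[symmetric] by (intro indep_setD) auto
  next
    assume "X \<in> measurable M S" "Y \<in> measurable M T"
      "\<forall>A\<in>sets S. \<forall>B\<in>sets T. prob {\<omega> \<in> space M. X \<omega> \<in> A \<and> Y \<omega> \<in> B} =
        prob {\<omega> \<in> space M. X \<omega> \<in> A} * prob {\<omega> \<in> space M. Y \<omega> \<in> B}"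
    then show "indep_set {{\<omega> \<in> space M. X \<omega> \<in> A} |A. A \<in> sets S} {{\<omega> \<in> space M. Y \<omega> \<in> B} |B. B \<in> sets T}"
      by (intro indep_setI) (auto simp: inter)
  qed
qed

lemma indep_rvs_commute:
  assumes "prob_space M" "indep_rvs M S X T Y"
  shows "indep_rvs M T Y S X"
  using assms(2) unfolding indep_rvs_iff[OF assms(1)] by (simp add: conj_commute mult.commute)

lemma indep_rvs_compose:
  assumes "prob_space M" "indep_rvs M S X T Y"
    and f: "f \<in> measurable S S'" and g: "g \<in> measurable T T'"
  shows "indep_rvs M S' (\<lambda>\<omega>. f (X \<omega>)) T' (\<lambda>\<omega>. g (Y \<omega>))"
  unfolding indep_rvs_iff[OF assms(1)]
proof (intro conjI ballI)
  note indep = assms(2)[unfolded indep_rvs_iff[OF assms(1)]]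
  show X: "(\<lambda>\<omega>. f (X \<omega>)) \<in> measurable M S'" and Y: "(\<lambda>\<omega>. g (Y \<omega>)) \<in> measurable M T'"
    using indep f g by (auto intro: measurable_compose)
  fix A B assume AB: "A \<in> sets S'" "B \<in> sets T'"
  have "X \<omega> \<in> space S" "Y \<omega> \<in> space T" if "\<omega> \<in> space M" for \<omega>
    using indep that by (auto dest: measurable_space)
  then show "emeasure M {\<omega> \<in> space M. f (X \<omega>) \<in> A \<and> g (Y \<omega>) \<in> B} =
      emeasure M {\<omega> \<in> space M. f (X \<omega>) \<in> A} * emeasure M {\<omega> \<in> space M. g (Y \<omega>) \<in> B}"
    using indep[THEN conjunct2, THEN conjunct2, rule_format,
        OF measurable_sets[OF f AB(1)] measurable_sets[OF g AB(2)]]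
    by (simp cong: conj_cong)
qed

lemma distr_pair_indep_rvs:
  assumes "prob_space M" "indep_rvs M S X T Y"
  shows "distr M (S \<Otimes>\<^sub>M T) (\<lambda>\<omega>. (X \<omega>, Y \<omega>)) = distr M S X \<Otimes>\<^sub>M distr M T Y"
proof (rule pair_measure_eqI[symmetric])
  note indep = assms(2)[unfolded indep_rvs_iff[OF assms(1)]]
  have [measurable]: "X \<in> measurable M S" "Y \<in> measurable M T"
    using indep by auto
  interpret X: prob_space "distr M S X"
    by (rule prob_space.prob_space_distr[OF assms(1)]) measurable
  interpret Y: prob_space "distr M T Y"
    by (rule prob_space.prob_space_distr[OF assms(1)]) measurable
  show "sigma_finite_measure (distr M S X)" "sigma_finite_measure (distr M T Y)" ..
  fix A B assume "A \<in> sets (distr M S X)" "B \<in> sets (distr M T Y)"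
  then have [measurable]: "A \<in> sets S" "B \<in> sets T" by auto
  have "X -` A \<inter> space M = {\<omega> \<in> space M. X \<omega> \<in> A}" "Y -` B \<inter> space M = {\<omega> \<in> space M. Y \<omega> \<in> B}"
    "(\<lambda>\<omega>. (X \<omega>, Y \<omega>)) -` (A \<times> B) \<inter> space M = {\<omega> \<in> space M. X \<omega> \<in> A \<and> Y \<omega> \<in> B}"
    by auto
  then show "emeasure (distr M S X) A * emeasure (distr M T Y) B =
      emeasure (distr M (S \<Otimes>\<^sub>M T) (\<lambda>\<omega>. (X \<omega>, Y \<omega>))) (A \<times> B)"
    using indep by (simp add: emeasure_distr)
qed (simp cong: sets_pair_measure_cong)

text \<open>
  Unlike uniqueness of distribution functions, this covers infinite measures. That is what the law
  of the norm under Lebesgue measure calls for.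
\<close>

lemma measure_eqI_atMost:
  fixes M N :: "real measure"
  assumes "sets M = sets borel" "sets N = sets borel"
    and "\<And>t. emeasure M {..t} = emeasure N {..t}" "\<And>t. emeasure M {..t} \<noteq> \<infinity>"
  shows "M = N"
proof (rule measure_eqI_generator_eq[where E="range atMost" and \<Omega>=UNIV and A="\<lambda>n. {..real n}"])
  show "Int_stable (range (atMost :: real \<Rightarrow> _))"
    by (auto simp: Int_stable_def)
  show "(\<Union>n. {..real n}) = UNIV"
    using real_arch_simple by auto
  show "sets M = sigma_sets UNIV (range atMost)" "sets N = sigma_sets UNIV (range atMost)"
    using assms(1,2) by (simp_all add: borel_eq_atMost)
qed (use assms in auto)

section \<open>The Minkowski functional of a symmetric convex body\<close>

locale symmetric_body =
  fixes K :: "'a::euclidean_space set"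
  assumes symmetric_convex_body: "symmetric_convex_body K"
begin

abbreviation body_norm :: "'a \<Rightarrow> real" where
  "body_norm \<equiv> minkowski_functional K"

abbreviation radial_projection :: "'a \<Rightarrow> 'a" where
  "radial_projection x \<equiv> x /\<^sub>R body_norm x"

lemma compact_body: "compact K" and convex_body: "convex K"
  using symmetric_convex_body by (auto simp: symmetric_convex_body_def)

lemma closed_body: "closed K"
  by (simp add: compact_body compact_imp_closed)

lemma borel_body [measurable]: "K \<in> sets borel"
  by (simp add: closed_body)

text \<open>The origin is the midpoint of an interior point and its mirror image.\<close>

lemma zero_in_interior: "0 \<in> interior K"
proof -
  obtain c where c: "c \<in> interior K"
    using symmetric_convex_body by (auto simp: symmetric_convex_body_def)
  have "uminus ` K = K"
  proof
    show "uminus ` K \<subseteq> K"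
      using symmetric_convex_body by (auto simp: symmetric_convex_body_def)
    show "K \<subseteq> uminus ` K"
    proof
      fix x assume "x \<in> K"
      then have "- x \<in> K"
        using symmetric_convex_body by (auto simp: symmetric_convex_body_def)
      then show "x \<in> uminus ` K" by (metis add.inverse_inverse imageI)
    qed
  qed
  then have "- c \<in> interior K"
    using c interior_negations[of K] by auto
  then have "(1/2) *\<^sub>R c + (1/2) *\<^sub>R (- c) \<in> interior K"
    using c convex_interior[OF convex_body] by (intro convexD) auto
  then show ?thesis by simp
qed

lemma zero_in_body: "0 \<in> K"
  using zero_in_interior interior_subset by blast

text \<open>
  A small ball around the origin lies in \<open>K\<close>. The infimum that defines the norm is therefore over a
  non-empty set, which is what \<open>body_norm_greatest\<close> depends on.
\<close>

lemma absorbing: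
  obtains r where "r > 0" "x \<in> (*\<^sub>R) r ` K"
proof -
  obtain e where e: "e > 0" "ball 0 e \<subseteq> K"
    using zero_in_interior mem_interior by blast
  define r where "r = (norm x + 1) / (e / 2)"
  have r: "r > 0"
    using e by (simp add: r_def add_nonneg_pos)
  have "norm (x /\<^sub>R r) < e"
  proof -
    have "norm (x /\<^sub>R r) = (e / 2) * (norm x / (norm x + 1))"
      using e by (simp add: r_def divide_simps)
    also have "\<dots> \<le> (e / 2) * 1"
      using e by (intro mult_left_mono) (auto simp: divide_simps add_nonneg_pos)
    finally show ?thesis using e by simp
  qed
  then have "x /\<^sub>R r \<in> K" using e by auto
  then have "r *\<^sub>R (x /\<^sub>R r) \<in> (*\<^sub>R) r ` K" by blast
  then show ?thesis using r that[of r] by simp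
qed

lemma body_norm_le: "r > 0 \<Longrightarrow> x \<in> (*\<^sub>R) r ` K \<Longrightarrow> body_norm x \<le> r"
  unfolding minkowski_functional_def
  by (rule cInf_lower) (auto intro!: bdd_belowI[of _ 0])

lemma body_norm_greatest:
  "(\<And>r. r > 0 \<Longrightarrow> x \<in> (*\<^sub>R) r ` K \<Longrightarrow> t \<le> r) \<Longrightarrow> t \<le> body_norm x"
  unfolding minkowski_functional_def
  using absorbing[of x] by (intro cInf_greatest) blast+

lemma body_norm_nonneg [simp]: "0 \<le> body_norm x"
  by (rule body_norm_greatest) simp

lemma body_norm_zero [simp]: "body_norm 0 = 0"
proof (rule antisym)
  have "body_norm 0 \<le> r" if "r > 0" for r
    using body_norm_le[OF that, of 0] zero_in_body by (metis imageI scaleR_zero_right)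
  then show "body_norm 0 \<le> 0"
    by (meson dense_ge)
qed simp

text \<open>
  Boundedness of \<open>K\<close> enters here: if \<open>K\<close> lies in the ball of radius \<open>B\<close>, then the norm of \<open>x\<close> is at
  least \<open>norm x / B\<close>.
\<close>

lemma body_norm_eq_0_iff [simp]: "body_norm x = 0 \<longleftrightarrow> x = 0"
proof
  obtain B where B: "B > 0" "\<And>k. k \<in> K \<Longrightarrow> norm k \<le> B"
    using compact_imp_bounded[OF compact_body] by (auto simp: bounded_pos)
  assume "body_norm x = 0"
  moreover have "norm x / B \<le> body_norm x"
  proof (rule body_norm_greatest)
    fix r assume r: "r > 0" "x \<in> (*\<^sub>R) r ` K"
    then obtain k where "k \<in> K" "x = r *\<^sub>R k" by auto
    then show "norm x / B \<le> r"
      using r B by (simp add: field_simps)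
  qed
  ultimately show "x = 0"
    using B by (simp add: field_simps)
qed simp

lemma body_norm_pos_iff [simp]: "0 < body_norm x \<longleftrightarrow> x \<noteq> 0"
  by (metis body_norm_eq_0_iff body_norm_nonneg less_le)

lemma body_norm_scaleR:
  assumes "c > 0"
  shows "body_norm (c *\<^sub>R x) = c * body_norm x"
proof -
  have le: "body_norm (c *\<^sub>R x) \<le> c * body_norm x" if c: "c > 0" for c x
  proof -
    have "body_norm (c *\<^sub>R x) / c \<le> body_norm x"
    proof (rule body_norm_greatest)
      fix r assume r: "r > 0" "x \<in> (*\<^sub>R) r ` K"
      then obtain k where k: "k \<in> K" "x = r *\<^sub>R k" by auto
      have "c *\<^sub>R x \<in> (*\<^sub>R) (c * r) ` K" using k by auto
      then show "body_norm (c *\<^sub>R x) / c \<le> r"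
        using body_norm_le[of "c * r" "c *\<^sub>R x"] c r by (simp add: field_simps)
    qed
    then show ?thesis using c by (simp add: field_simps)
  qed
  have "body_norm x \<le> (1 / c) * body_norm (c *\<^sub>R x)"
    using le[of "1 / c" "c *\<^sub>R x"] assms by simp
  then show ?thesis
    using le[OF assms, of x] assms by (simp add: field_simps)
qed

text \<open>
  A point of norm at most one need not be known to attain the infimum; but every smaller multiple of
  it lies in \<open>K\<close>, and \<open>K\<close> is closed.
\<close>

lemma body_norm_le_1_iff: "body_norm x \<le> 1 \<longleftrightarrow> x \<in> K"
proof
  assume "x \<in> K" then show "body_norm x \<le> 1"
    using body_norm_le[of 1 x] by simp
next
  assume le: "body_norm x \<le> 1"
  have *: "(1 - 1 / real (Suc n)) *\<^sub>R x \<in> K" for n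
  proof -
    define s where "s = 1 - 1 / real (Suc n)"
    have s: "0 \<le> s" "s < 1" by (auto simp: s_def)
    show ?thesis
    proof (cases "s = 0")
      case True then show ?thesis using zero_in_body by (simp add: s_def)
    next
      case False
      then have s0: "s > 0" using s by simp
      then have "1 < 1 / s" using s by simp
      then have "body_norm x < 1 / s" using le by linarith
      then obtain r where r: "r > 0" "x \<in> (*\<^sub>R) r ` K" "r < 1 / s"
        using body_norm_greatest[of x "1 / s"] by (meson not_le)
      then obtain k where k: "k \<in> K" "x = r *\<^sub>R k" by auto
      have "(s * r) *\<^sub>R k + (1 - s * r) *\<^sub>R 0 \<in> K"
        using k zero_in_body r s0 by (intro convexD[OF convex_body]) (auto simp: field_simps)
      then show ?thesis using k by (simp add: s_def)
    qed
  qed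
  have "(\<lambda>n. (1 - 1 / real (Suc n)) *\<^sub>R x) \<longlonglongrightarrow> (1 - 0) *\<^sub>R x"
    by (intro tendsto_intros LIMSEQ_Suc[OF lim_1_over_n])
  then show "x \<in> K"
    using closed_sequentially[OF closed_body] * by fastforce
qed

text \<open>Shrinking a point of a convex set towards an interior point moves it into the interior.\<close>

lemma body_norm_less_1_imp_interior:
  assumes "body_norm x < 1"
  shows "x \<in> interior K"
proof -
  obtain r where r: "r > 0" "x \<in> (*\<^sub>R) r ` K" "r < 1"
    using assms body_norm_greatest[of x 1] by (meson not_le)
  then obtain k where k: "k \<in> K" "x = r *\<^sub>R k" by auto
  have "k - (1 - r) *\<^sub>R (k - 0) \<in> interior K"
    using r k by (intro mem_interior_convex_shrink[OF convex_body zero_in_interior]) auto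
  then show ?thesis using k by (simp add: algebra_simps)
qed

text \<open>An interior point can be stretched by a factor \<open>1 + d\<close> without leaving \<open>K\<close>.\<close>

lemma interior_imp_body_norm_less_1:
  assumes "x \<in> interior K"
  shows "body_norm x < 1"
proof (cases "x = 0")
  case False
  obtain e where e: "e > 0" "ball x e \<subseteq> K"
    using assms mem_interior by blast
  define d where "d = e / (2 * norm x)"
  have d: "d > 0" using e False by (simp add: d_def)
  have "dist x ((1 + d) *\<^sub>R x) = d * norm x"
    using d by (simp add: dist_norm algebra_simps)
  also have "\<dots> < e" using e False by (simp add: d_def)
  finally have "(1 + d) *\<^sub>R x \<in> K" using e by auto
  then have "(1 + d) * body_norm x \<le> 1"
    using body_norm_scaleR[of "1 + d" x] d body_norm_le_1_iff[of "(1 + d) *\<^sub>R x"] by (simp del: scaleR_left.add)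
  moreover have "body_norm x < (1 + d) * body_norm x"
    using d False by simp
  ultimately show ?thesis by linarith
qed simp

lemma frontier_eq_body_norm_sphere: "frontier K = {x. body_norm x = 1}"
  using body_norm_le_1_iff body_norm_less_1_imp_interior interior_imp_body_norm_less_1 closed_body
  by (force simp: frontier_def)

lemma body_norm_radial_projection: "x \<noteq> 0 \<Longrightarrow> body_norm (radial_projection x) = 1"
  using body_norm_scaleR[of "inverse (body_norm x)" x] by simp

lemma radial_projection_scaleR:
  "c > 0 \<Longrightarrow> radial_projection (c *\<^sub>R x) = radial_projection x"
  by (simp add: body_norm_scaleR)

lemma body_norm_scaleR_radial_projection: "body_norm x *\<^sub>R radial_projection x = x"
  by (cases "x = 0") auto

lemma body_norm_ball_eq:
  assumes "a > 0"
  shows "{x. body_norm x \<le> a} = (*\<^sub>R) a ` K"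
proof -
  have "body_norm x \<le> a \<longleftrightarrow> x /\<^sub>R a \<in> K" for x
  proof -
    have "body_norm (x /\<^sub>R a) = body_norm x / a"
      using body_norm_scaleR[of "inverse a" x] assms by (simp add: divide_inverse_commute)
    then show ?thesis
      using assms body_norm_le_1_iff[of "x /\<^sub>R a"] by simp
  qed
  moreover have "x /\<^sub>R a \<in> K \<longleftrightarrow> x \<in> (*\<^sub>R) a ` K" for x
    using assms by (force simp: image_iff intro: bexI[of _ "x /\<^sub>R a"])
  ultimately show ?thesis by blast
qed

lemma measurable_body_norm [measurable]: "body_norm \<in> borel_measurable borel"
proof (rule borel_measurable_iff_le[THEN iffD2], safe)
  fix a :: real
  consider "a < 0" | "a = 0" | "a > 0" by linarith
  then show "{x \<in> space borel. body_norm x \<le> a} \<in> sets borel"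
  proof cases
    case 1
    then have "{x \<in> space borel. body_norm x \<le> a} = {}"
      using body_norm_nonneg by (auto simp: not_le intro: less_le_trans)
    then show ?thesis by simp
  next
    case 2
    then have "{x \<in> space borel. body_norm x \<le> a} = {0}"
      using body_norm_nonneg body_norm_eq_0_iff order.antisym by fastforce
    then show ?thesis by simp
  next
    case 3
    then show ?thesis
      using body_norm_ball_eq[OF 3] closed_scaling[OF closed_body, of a] by simp
  qed
qed

lemma measurable_radial_projection [measurable]:
  "radial_projection \<in> borel_measurable borel"
  by measurable

section \<open>Polar factorization of Lebesgue measure\<close>

lemma emeasure_body_finite: "emeasure lborel K < \<infinity>"
  using emeasure_bounded_finite[OF compact_imp_bounded[OF compact_body]] by simp

lemma emeasure_body_pos: "emeasure lborel K \<noteq> 0"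
proof
  assume "emeasure lborel K = 0"
  then have "K \<in> null_sets lborel" by (auto intro: null_setsI)
  then have "negligible K"
    by (simp add: negligible_iff_null_sets null_sets_completionI)
  then have "negligible (interior K)"
    using interior_subset negligible_subset by blast
  then show False
    using open_not_negligible[OF open_interior] zero_in_interior by blast
qed

definition uniform_law :: "'a measure" where
  "uniform_law = uniform_measure lborel K"

text \<open>
  The cone measure, regarded as a measure on the whole space. As the image of a probability measure
  it is countably additive by construction.
\<close>

definition direction_law :: "'a measure" where
  "direction_law = distr uniform_law borel radial_projection"

lemma sets_uniform_law [simp, measurable_cong]: "sets uniform_law = sets borel"
  by (simp add: uniform_law_def)

lemma space_uniform_law [simp]: "space uniform_law = UNIV"
  by (simp add: uniform_law_def)

lemma sets_direction_law [simp, measurable_cong]: "sets direction_law = sets borel"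
  by (simp add: direction_law_def)

lemma space_direction_law [simp]: "space direction_law = UNIV"
  by (simp add: direction_law_def)

lemma prob_space_uniform_law: "prob_space uniform_law"
  unfolding uniform_law_def
  using emeasure_body_pos emeasure_body_finite by (intro prob_space_uniform_measure) auto

lemma emeasure_direction_law:
  assumes [measurable]: "A \<in> sets borel"
  shows "emeasure direction_law A =
    emeasure lborel {x \<in> K. radial_projection x \<in> A} / emeasure lborel K"
proof -
  have "emeasure direction_law A = emeasure uniform_law {x. radial_projection x \<in> A}"
    unfolding direction_law_def
    by (subst emeasure_distr) (auto simp: vimage_def)
  also have "\<dots> = emeasure lborel (K \<inter> {x. radial_projection x \<in> A}) / emeasure lborel K"
    unfolding uniform_law_def by (subst emeasure_uniform_measure) measurable
  also have "K \<inter> {x. radial_projection x \<in> A} = {x \<in> K. radial_projection x \<in> A}" by auto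
  finally show ?thesis .
qed

text \<open>Directions do not change under dilation, and the norm scales by the factor of dilation.\<close>

lemma emeasure_cone_dilate:
  assumes [measurable]: "A \<in> sets borel" and a: "a > 0"
  shows "emeasure lborel {x. radial_projection x \<in> A \<and> body_norm x \<le> a} =
    ennreal (a ^ DIM('a)) * emeasure lborel {x \<in> K. radial_projection x \<in> A}"
proof -
  have eq: "{x. radial_projection x \<in> A \<and> body_norm x \<le> a} =
      (\<lambda>x. a *\<^sub>R x + 0) ` {x \<in> K. radial_projection x \<in> A}"
    (is "?L = ?R")
  proof
    show "?L \<subseteq> ?R"
    proof
      fix x assume x: "x \<in> ?L"
      then obtain k where k: "k \<in> K" "x = a *\<^sub>R k"
        using body_norm_ball_eq[OF a] by auto
      then have "radial_projection k \<in> A"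
        using x radial_projection_scaleR[OF a, of k] by (simp only: mem_Collect_eq)
      then show "x \<in> ?R" using k by auto
    qed
    show "?R \<subseteq> ?L"
    proof (rule image_subsetI)
      fix k assume "k \<in> {x \<in> K. radial_projection x \<in> A}"
      then show "a *\<^sub>R k + 0 \<in> ?L"
        using radial_projection_scaleR[OF a, of k] body_norm_ball_eq[OF a]
        by (simp only: mem_Collect_eq add_0_right) blast
    qed
  qed
  have "emeasure lebesgue ?L = ennreal (\<bar>a\<bar> ^ DIM('a)) *
      emeasure lebesgue {x \<in> K. radial_projection x \<in> A}"
    unfolding eq by (rule emeasure_lebesgue_affine)
  then show ?thesis
    using a by (simp add: emeasure_completion)
qed

text \<open>
  For positive \<open>a\<close>, both volumes carry the same power of \<open>a\<close>, which leaves the ratio of the volumes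
  at \<open>a = 1\<close>. Otherwise at most the origin is left, a null set.
\<close>

lemma emeasure_cone_factor:
  assumes [measurable]: "A \<in> sets borel"
  shows "emeasure lborel {x. radial_projection x \<in> A \<and> body_norm x \<le> a} =
    emeasure direction_law A * emeasure lborel {x. body_norm x \<le> a}"
proof (cases "a > 0")
  case True
  have "emeasure lborel {x. body_norm x \<le> a} = ennreal (a ^ DIM('a)) * emeasure lborel K"
    using emeasure_cone_dilate[of UNIV a] True by simp
  then have "emeasure direction_law A * emeasure lborel {x. body_norm x \<le> a} =
     ennreal (a ^ DIM('a)) * (emeasure lborel {x \<in> K. radial_projection x \<in> A} / emeasure lborel K * emeasure lborel K)"
    by (simp add: emeasure_direction_law mult_ac)
  also have "emeasure lborel {x \<in> K. radial_projection x \<in> A} / emeasure lborel K * emeasure lborel K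
     = emeasure lborel {x \<in> K. radial_projection x \<in> A}"
    using emeasure_body_pos emeasure_body_finite
    by (simp add: ennreal_divide_times ennreal_divide_self)
  finally show ?thesis
    using emeasure_cone_dilate[OF assms True] by simp
next
  case False
  then have sub: "{x. body_norm x \<le> a} \<subseteq> {0}"
    using body_norm_nonneg body_norm_eq_0_iff order.antisym order.trans not_less
    by (smt (verit) mem_Collect_eq singletonI subsetI)
  have "emeasure lborel S = 0" if "S \<subseteq> {x. body_norm x \<le> a}" for S
    using that sub by (intro emeasure_lborel_countable) (meson countable_empty countable_insert countable_subset)
  then show ?thesis
    by (metis (no_types, lifting) Collect_mono_iff mult_zero_right order_refl)
qed

text \<open>
  The polar integration formula. For fixed \<open>A\<close>, the law of the norm under Lebesgue measure restricted
  to the directions in \<open>A\<close> is a multiple of the law of the norm under Lebesgue measure itself, since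
  the two agree on initial segments.
\<close>

lemma nn_integral_cone_factor:
  assumes A [measurable]: "A \<in> sets borel" and h [measurable]: "h \<in> borel_measurable borel"
  shows "(\<integral>\<^sup>+ x. h (body_norm x) * indicator {x. radial_projection x \<in> A} x \<partial>lborel) =
    emeasure direction_law A * (\<integral>\<^sup>+ x. h (body_norm x) \<partial>lborel)"
proof -
  define C where "C = {x. radial_projection x \<in> A}"
  have C [measurable]: "C \<in> sets borel" unfolding C_def by measurable
  define m where "m = distr (density lborel (indicator C)) borel body_norm"
  define m' where "m' = scale_measure (emeasure direction_law A) (distr lborel borel body_norm)"
  have m: "emeasure m {..a} = emeasure lborel {x. radial_projection x \<in> A \<and> body_norm x \<le> a}" for a
  proof -
    have "emeasure m {..a} = emeasure (density lborel (indicator C)) {x. body_norm x \<le> a}"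
      unfolding m_def by (subst emeasure_distr) (auto simp: vimage_def)
    also have "\<dots> = emeasure lborel (C \<inter> {x. body_norm x \<le> a})"
      by (subst emeasure_density) (auto simp flip: indicator_inter_arith)
    also have "C \<inter> {x. body_norm x \<le> a} = {x. radial_projection x \<in> A \<and> body_norm x \<le> a}"
      by (auto simp: C_def)
    finally show ?thesis .
  qed
  have m': "emeasure m' {..a} = emeasure direction_law A * emeasure lborel {x. body_norm x \<le> a}" for a
    unfolding m'_def by (simp add: emeasure_distr vimage_def)
  have "m = m'"
  proof (rule measure_eqI_atMost)
    fix t
    \<comment> \<open>The radius \<open>t\<close> may be negative; \<open>\<bar>t\<bar> + 1\<close> is a positive one that is at least as large.\<close>
    have "{x. body_norm x \<le> \<bar>t\<bar> + 1} = (*\<^sub>R) (\<bar>t\<bar> + 1) ` K"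
      by (rule body_norm_ball_eq) simp
    then have "bounded {x. body_norm x \<le> \<bar>t\<bar> + 1}"
      using bounded_scaling[OF compact_imp_bounded[OF compact_body]] by metis
    then have "bounded {x. radial_projection x \<in> A \<and> body_norm x \<le> t}"
      by (rule bounded_subset) auto
    then show "emeasure m {..t} \<noteq> \<infinity>"
      using emeasure_bounded_finite unfolding m by force
  qed (auto simp: m m' emeasure_cone_factor m_def[THEN arg_cong[of _ _ sets]] m'_def[THEN arg_cong[of _ _ sets]])
  have "(\<integral>\<^sup>+ x. h (body_norm x) * indicator C x \<partial>lborel) = (\<integral>\<^sup>+ t. h t \<partial>m)"
    unfolding m_def
    by (subst nn_integral_distr, simp, simp, subst nn_integral_density) (auto simp: mult.commute)
  also have "\<dots> = emeasure direction_law A * (\<integral>\<^sup>+ x. h (body_norm x) \<partial>lborel)"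
    unfolding \<open>m = m'\<close> m'_def
    by (subst nn_integral_scale_measure) (auto simp: nn_integral_distr)
  finally show ?thesis by (simp add: C_def)
qed


section \<open>Cone measure as the law of the direction\<close>

text \<open>
  Every non-zero point of the cone over \<open>B\<close> has its direction in \<open>B\<close> and norm at most one, and
  conversely. So the cone and \<open>{x \<in> K. x/|x| \<in> B}\<close> differ at most by the origin. The set function
  that defines the cone measure thus agrees with a measure on all Borel subsets of the boundary.
\<close>

lemma cone_measure_eq: "cone_measure K = restrict_space direction_law (frontier K)"
proof -
  have F [measurable]: "frontier K \<in> sets borel"
    by simp
  have sets: "sets (restrict_space borel (frontier K)) = sets (restrict_space direction_law (frontier K))"
    by (intro sets_restrict_space_cong) simp
  have "emeasure lborel (dilates {0..1} B) / emeasure lborel K =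
      emeasure (restrict_space direction_law (frontier K)) B"
    if "B \<in> sets (restrict_space borel (frontier K))" for B
  proof -
    have B: "B \<subseteq> frontier K" and [measurable]: "B \<in> sets borel"
      using that by (auto simp: sets_restrict_space_iff)
    define C where "C = {x \<in> K. radial_projection x \<in> B}"
    have [measurable]: "C \<in> sets borel"
      unfolding C_def by measurable
    have C0: "0 \<notin> C"
      using B by (auto simp: C_def frontier_eq_body_norm_sphere)
    have "dilates {0..1} B - {0} = C"
    proof (intro equalityI subsetI)
      fix x assume "x \<in> dilates {0..1} B - {0}"
      then obtain r b where rb: "x = r *\<^sub>R b" "0 \<le> r" "r \<le> 1" "b \<in> B" "x \<noteq> 0"
        by (auto simp: dilates_def)
      then have "r > 0" "body_norm b = 1"
        using B by (auto simp: frontier_eq_body_norm_sphere order_less_le)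
      then show "x \<in> C"
        using rb body_norm_scaleR[of r b] body_norm_le_1_iff[of x]
        by (auto simp: C_def)
    next
      fix x assume x: "x \<in> C"
      then have "x = body_norm x *\<^sub>R radial_projection x" "body_norm x \<le> 1" "radial_projection x \<in> B"
        using body_norm_le_1_iff[of x] body_norm_scaleR_radial_projection[of x] by (auto simp: C_def)
      then show "x \<in> dilates {0..1} B - {0}"
        using x C0 body_norm_nonneg[of x] unfolding dilates_def atLeastAtMost_iff by blast
    qed
    then have "dilates {0..1} B = C \<or> dilates {0..1} B = insert 0 C"
      by blast
    then have "emeasure lborel (dilates {0..1} B) = emeasure lborel C"
      using C0 by (auto simp: emeasure_insert)
    then show ?thesis
      using B by (simp add: emeasure_restrict_space emeasure_direction_law C_def)
  qed
  then have "cone_measure K = measure_of (frontier K) (sets (restrict_space borel (frontier K)))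
      (emeasure (restrict_space direction_law (frontier K)))"
    unfolding cone_measure_def
    using sets.sigma_sets_eq[of "restrict_space borel (frontier K)"]
      sets.space_closed[of "restrict_space borel (frontier K)"]
    by (intro measure_of_eq) (simp_all add: space_restrict_space)
  then show ?thesis
    using measure_of_of_measure[of "restrict_space direction_law (frontier K)"]
    unfolding sets by (simp add: space_restrict_space)
qed

text \<open>Only the origin has a direction off the boundary.\<close>

lemma emeasure_direction_law_frontier: "emeasure direction_law (- frontier K) = 0"
proof -
  have "{x \<in> K. radial_projection x \<in> - frontier K} \<subseteq> {0}"
    using body_norm_radial_projection by (auto simp: frontier_eq_body_norm_sphere)
  then have "emeasure lborel {x \<in> K. radial_projection x \<in> - frontier K} = 0"
    by (meson countable_empty countable_insert countable_subset emeasure_lborel_countable)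
  then show ?thesis
    by (simp add: emeasure_direction_law)
qed

lemma distr_cone_measure: "distr (cone_measure K) borel (\<lambda>x. x) = direction_law"
proof (rule measure_eqI)
  fix A assume "A \<in> sets (distr (cone_measure K) borel (\<lambda>x. x))"
  then have [measurable]: "A \<in> sets borel" by simp
  have "(\<lambda>x. x) \<in> measurable (restrict_space direction_law (frontier K)) borel"
    by (intro measurable_restrict_space1) simp
  then have "emeasure (distr (cone_measure K) borel (\<lambda>x. x)) A =
      emeasure (restrict_space direction_law (frontier K)) (A \<inter> frontier K)"
    by (simp add: cone_measure_eq emeasure_distr space_restrict_space)
  also have "\<dots> = emeasure direction_law (A \<inter> frontier K)"
    by (simp add: emeasure_restrict_space)
  also have "\<dots> = emeasure direction_law A"
  proof (rule emeasure_eq_AE)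
    have "- frontier K \<in> null_sets direction_law"
      by (simp add: null_sets_def emeasure_direction_law_frontier)
    then show "AE x in direction_law. x \<in> A \<inter> frontier K \<longleftrightarrow> x \<in> A"
      by (rule AE_I') auto
  qed auto
  finally show "emeasure (distr (cone_measure K) borel (\<lambda>x. x)) A = emeasure direction_law A" .
qed simp

section \<open>Direction and norm of a vector with norm-dependent density\<close>

text \<open>
  The event that the norm lies in \<open>T\<close> is absorbed into the density: \<open>h\<close> is replaced by \<open>h\<close> cut off
  outside \<open>T\<close>, still a function of the norm, and the polar formula pulls out the direction.
\<close>

lemma
  assumes M: "prob_space M" and Z [measurable]: "Z \<in> borel_measurable M"
    and h [measurable]: "h \<in> borel_measurable borel"
    and dens: "\<And>A. A \<in> sets borel \<Longrightarrow> emeasure M {\<omega> \<in> space M. Z \<omega> \<in> A} =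
      (\<integral>\<^sup>+ x \<in> A. h (body_norm x) \<partial>lborel)"
  shows distr_direction: "distr M borel (\<lambda>\<omega>. radial_projection (Z \<omega>)) = direction_law"
    and indep_direction_norm:
      "indep_rvs M borel (\<lambda>\<omega>. radial_projection (Z \<omega>)) borel (\<lambda>\<omega>. body_norm (Z \<omega>))"
proof -
  interpret prob_space M by (rule M)
  have joint: "emeasure M {\<omega> \<in> space M. radial_projection (Z \<omega>) \<in> A \<and> body_norm (Z \<omega>) \<in> T} =
      emeasure direction_law A * emeasure M {\<omega> \<in> space M. body_norm (Z \<omega>) \<in> T}"
    if [measurable]: "A \<in> sets borel" "T \<in> sets borel" for A T
  proof -
    define hT where "hT t = h t * indicator T t" for t
    have [measurable]: "hT \<in> borel_measurable borel"
      unfolding hT_def by measurable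
    have "{\<omega> \<in> space M. radial_projection (Z \<omega>) \<in> A \<and> body_norm (Z \<omega>) \<in> T} =
        {\<omega> \<in> space M. Z \<omega> \<in> {x. radial_projection x \<in> A \<and> body_norm x \<in> T}}" by auto
    also have "emeasure M \<dots> =
        (\<integral>\<^sup>+ x. h (body_norm x) * indicator {x. radial_projection x \<in> A \<and> body_norm x \<in> T} x \<partial>lborel)"
      by (rule dens) measurable
    also have "\<dots> = (\<integral>\<^sup>+ x. hT (body_norm x) * indicator {x. radial_projection x \<in> A} x \<partial>lborel)"
      by (intro nn_integral_cong) (auto simp: hT_def split: split_indicator)
    also have "\<dots> = emeasure direction_law A * (\<integral>\<^sup>+ x. hT (body_norm x) \<partial>lborel)"
      by (rule nn_integral_cone_factor) measurable
    also have "(\<integral>\<^sup>+ x. hT (body_norm x) \<partial>lborel) =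
        (\<integral>\<^sup>+ x. h (body_norm x) * indicator {x. body_norm x \<in> T} x \<partial>lborel)"
      by (intro nn_integral_cong) (auto simp: hT_def split: split_indicator)
    also have "\<dots> = emeasure M {\<omega> \<in> space M. Z \<omega> \<in> {x. body_norm x \<in> T}}"
      by (rule dens[symmetric]) measurable
    finally show ?thesis by simp
  qed
  have dir: "emeasure M {\<omega> \<in> space M. radial_projection (Z \<omega>) \<in> A} = emeasure direction_law A"
    if "A \<in> sets borel" for A
    using joint[OF that, of UNIV] by (simp add: emeasure_space_1)
  show "distr M borel (\<lambda>\<omega>. radial_projection (Z \<omega>)) = direction_law"
    using dir by (intro measure_eqI) (auto simp: emeasure_distr vimage_def Int_def conj_commute)
  show "indep_rvs M borel (\<lambda>\<omega>. radial_projection (Z \<omega>)) borel (\<lambda>\<omega>. body_norm (Z \<omega>))"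
    unfolding indep_rvs_iff[OF M] using joint dir by simp
qed

section \<open>The norm of a uniform point\<close>

text \<open>
  Membership in \<open>K\<close> is a condition on the norm, which makes a uniform vector an instance of
  \<open>indep_direction_norm\<close>.
\<close>

lemma uniform_law_density:
  assumes [measurable]: "A \<in> sets borel"
  shows "emeasure uniform_law {x \<in> space uniform_law. x \<in> A} =
    (\<integral>\<^sup>+ x \<in> A. indicator {..1} (body_norm x) / emeasure lborel K \<partial>lborel)"
proof -
  have "emeasure uniform_law {x \<in> space uniform_law. x \<in> A} = emeasure lborel (K \<inter> A) / emeasure lborel K"
    by (simp add: uniform_law_def)
  also have "\<dots> = (\<integral>\<^sup>+ x. indicator (K \<inter> A) x / emeasure lborel K \<partial>lborel)"
    by (subst nn_integral_divide) auto
  also have "\<dots> = (\<integral>\<^sup>+ x \<in> A. indicator {..1} (body_norm x) / emeasure lborel K \<partial>lborel)"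
    using body_norm_le_1_iff by (intro nn_integral_cong) (auto split: split_indicator)
  finally show ?thesis .
qed

lemma emeasure_uniform_law_norm_le:
  assumes t: "0 \<le> t"
  shows "emeasure uniform_law {x. body_norm x \<le> t} = ennreal (min 1 t ^ DIM('a))"
proof -
  \<comment> \<open>Inside \<open>K\<close> the norm is at most one, so a bound \<open>t > 1\<close> acts like the bound one.\<close>
  define s where "s = min 1 t"
  have "emeasure uniform_law {x. body_norm x \<le> t} =
      emeasure lborel (K \<inter> {x. body_norm x \<le> t}) / emeasure lborel K"
    unfolding uniform_law_def by (rule emeasure_uniform_measure) measurable
  also have "K \<inter> {x. body_norm x \<le> t} = {x. body_norm x \<le> s}"
    using body_norm_le_1_iff by (auto simp: s_def)
  also have "emeasure lborel {x. body_norm x \<le> s} = ennreal (s ^ DIM('a)) * emeasure lborel K"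
  proof (cases "s = 0")
    case True
    then have "{x. body_norm x \<le> s} = {0}"
      using body_norm_nonneg body_norm_eq_0_iff order.antisym by fastforce
    then show ?thesis using True by simp
  next
    case False
    then have "s > 0" using t by (auto simp: s_def min_def split: if_splits)
    then show ?thesis using emeasure_cone_dilate[of UNIV s] by simp
  qed
  also have "\<dots> / emeasure lborel K = ennreal (s ^ DIM('a))"
    using emeasure_body_pos emeasure_body_finite by (intro ennreal_mult_divide_eq) auto
  finally show ?thesis by (simp add: s_def)
qed

text \<open>
  Both distribution functions equal \<open>min 1 t\<close> to the power of the dimension for non-negative \<open>t\<close>.
\<close>

lemma distr_norm_uniform_law:
  "distr uniform_law borel body_norm =
     distr (uniform_measure lborel {0..1}) borel (\<lambda>u. u powr (1 / real DIM('a)))"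
    (is "?L = distr ?U borel ?p")
proof (rule measure_eqI_atMost)
  interpret L: prob_space ?L
    by (intro prob_space.prob_space_distr prob_space_uniform_law) measurable
  show "emeasure ?L {..t} \<noteq> \<infinity>" for t by simp
  fix t :: real
  have "emeasure (distr ?U borel ?p) {..t} = emeasure ?U {u. ?p u \<le> t}"
    by (subst emeasure_distr) (auto simp: vimage_def)
  also have "\<dots> = emeasure lborel ({0..1} \<inter> {u. ?p u \<le> t})"
    by (subst emeasure_uniform_measure) (auto simp: divide_ennreal_def)
  also have "\<dots> = emeasure ?L {..t}"
  proof (cases "t < 0")
    case True
    have "\<not> ?p u \<le> t" for u using True powr_ge_zero[of u "1 / real DIM('a)"] by linarith
    moreover have "\<not> body_norm x \<le> t" for x using True body_norm_nonneg[of x] by linarith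
    ultimately show ?thesis by (simp add: emeasure_distr vimage_def)
  next
    case False
    have "?p u \<le> t \<longleftrightarrow> u \<le> t ^ DIM('a)" if "u \<ge> 0" for u
    proof -
      have "?p u \<ge> 0" by simp
      then have "?p u \<le> t \<longleftrightarrow> ?p u ^ DIM('a) \<le> t ^ DIM('a)"
        using False by (intro power_mono_iff[symmetric]) auto
      also have "?p u ^ DIM('a) = u"
        using that by (simp add: real_root_pow_pos2 flip: root_powr_inverse)
      finally show ?thesis .
    qed
    then have "{0..1} \<inter> {u. ?p u \<le> t} = {0..min 1 (t ^ DIM('a))}"
      by auto
    moreover have "min 1 (t ^ DIM('a)) = min 1 t ^ DIM('a)"
      using False by (cases "t \<le> 1") (auto simp: min_absorb1 min_absorb2 power_le_one)
    ultimately show ?thesis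
      using False emeasure_uniform_law_norm_le[of t] by (simp add: emeasure_distr vimage_def)
  qed
  finally show "emeasure ?L {..t} = emeasure (distr ?U borel ?p) {..t}" by simp
qed auto

text \<open>
  The pair \<open>(V, \<Theta>)\<close> and the pair of norm and direction of a uniform vector have the same product
  law, and the product of norm and direction is the vector.
\<close>

lemma distr_radius_direction:
  assumes M: "prob_space M" and indep: "indep_rvs M borel V borel \<Theta>"
    and V: "distr M borel V = distr uniform_law borel body_norm"
    and \<Theta>: "distr M borel \<Theta> = direction_law"
  shows "distr M borel (\<lambda>\<omega>. V \<omega> *\<^sub>R \<Theta> \<omega>) = uniform_law"
proof -
  have [measurable]: "V \<in> borel_measurable M" "\<Theta> \<in> borel_measurable M"
    using indep by (auto simp: indep_rvs_def)
  have "indep_rvs uniform_law borel radial_projection borel body_norm"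
    using uniform_law_density
    by (intro indep_direction_norm[where h="\<lambda>t. indicator {..1} t / emeasure lborel K"]
        prob_space_uniform_law) measurable
  then have indep': "indep_rvs uniform_law borel body_norm borel radial_projection"
    by (rule indep_rvs_commute[OF prob_space_uniform_law])
  have "distr M borel (\<lambda>\<omega>. V \<omega> *\<^sub>R \<Theta> \<omega>) =
      distr (distr M (borel \<Otimes>\<^sub>M borel) (\<lambda>\<omega>. (V \<omega>, \<Theta> \<omega>))) borel (\<lambda>(r, x). r *\<^sub>R x)"
    by (subst distr_distr) (auto simp: comp_def)
  also have "distr M (borel \<Otimes>\<^sub>M borel) (\<lambda>\<omega>. (V \<omega>, \<Theta> \<omega>)) =
      distr uniform_law (borel \<Otimes>\<^sub>M borel) (\<lambda>x. (body_norm x, radial_projection x))"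
    unfolding distr_pair_indep_rvs[OF M indep]
      distr_pair_indep_rvs[OF prob_space_uniform_law indep']
    by (simp add: V \<Theta> direction_law_def)
  also have "distr \<dots> borel (\<lambda>(r, x). r *\<^sub>R x) = distr uniform_law borel (\<lambda>x. body_norm x *\<^sub>R radial_projection x)"
    by (subst distr_distr) (auto simp: comp_def)
  also have "\<dots> = uniform_law"
    unfolding body_norm_scaleR_radial_projection by (rule distr_id2) simp
  finally show ?thesis .
qed

end

theorem proposition3p3:
  fixes K :: "(real ^ 'n) set"
    and f :: "real \<Rightarrow> real"
    and M :: "'m measure"
    and Z :: "'m \<Rightarrow> real ^ 'n"
    and U :: "'m \<Rightarrow> real"
  assumes "symmetric_convex_body K"
    and "continuous_on {0..} f"
    and "\<And>t. t \<ge> 0 \<Longrightarrow> f t \<ge> 0"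
    and "(\<integral>\<^sup>+ x. ennreal (f (minkowski_functional K x)) \<partial>lborel) = 1"
    and "prob_space M"
    and "Z \<in> borel_measurable M"
    and "\<And>A. A \<in> sets borel \<Longrightarrow>
           emeasure M {\<omega> \<in> space M. Z \<omega> \<in> A} =
             (\<integral>\<^sup>+ x \<in> A. ennreal (f (minkowski_functional K x)) \<partial>lborel)"
    and "has_law M U (uniform_measure lborel {0..1})"
    and "indep_rvs M borel U borel Z"
  shows "has_law M (\<lambda>\<omega>. Z \<omega> /\<^sub>R minkowski_functional K (Z \<omega>)) (cone_measure K)
    \<and> has_law M (\<lambda>\<omega>. U \<omega> powr (1 / real CARD('n)) *\<^sub>R
                     (Z \<omega> /\<^sub>R minkowski_functional K (Z \<omega>)))
        (uniform_measure lborel K)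
    \<and> indep_rvs M
        borel (\<lambda>\<omega>. Z \<omega> /\<^sub>R minkowski_functional K (Z \<omega>))
        borel (\<lambda>\<omega>. minkowski_functional K (Z \<omega>))"
proof (intro conjI)
  interpret symmetric_body K
    by unfold_locales fact
  interpret prob_space M by fact
  have Z [measurable]: "Z \<in> borel_measurable M" by fact
  have U [measurable]: "U \<in> borel_measurable M"
    and U_law: "distr M borel U = uniform_measure lborel {0..1}"
    using assms(8) by (auto simp: has_law_def intro: distr_id2)
  \<comment> \<open>Continuity of \<open>f\<close> on the half-line makes the extension by zero Borel; norms never leave the half-line.\<close>
  define h where "h t = ennreal (indicator {0..} t *\<^sub>R f t)" for t
  have h [measurable]: "h \<in> borel_measurable borel"
    unfolding h_def
    using borel_measurable_continuous_on_indicator[of "{0..}" f] assms(2) by simp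
  have dens: "emeasure M {\<omega> \<in> space M. Z \<omega> \<in> A} = (\<integral>\<^sup>+ x \<in> A. h (body_norm x) \<partial>lborel)"
    if "A \<in> sets borel" for A
    using assms(7)[OF that] by (simp add: h_def)
  have direction: "distr M borel (\<lambda>\<omega>. radial_projection (Z \<omega>)) = direction_law"
    by (rule distr_direction[OF assms(5) Z h dens])
  show "indep_rvs M borel (\<lambda>\<omega>. radial_projection (Z \<omega>)) borel (\<lambda>\<omega>. body_norm (Z \<omega>))"
    by (rule indep_direction_norm[OF assms(5) Z h dens])
  show "has_law M (\<lambda>\<omega>. radial_projection (Z \<omega>)) (cone_measure K)"
    by (simp add: has_law_def direction distr_cone_measure)
  define V where "V = (\<lambda>\<omega>. U \<omega> powr (1 / real CARD('n)))"
  have "distr M borel V = distr (distr M borel U) borel (\<lambda>u. u powr (1 / real CARD('n)))"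
    by (subst distr_distr) (auto simp: comp_def V_def)
  also have "\<dots> = distr uniform_law borel body_norm"
    by (simp add: U_law distr_norm_uniform_law)
  finally have V_law: "distr M borel V = distr uniform_law borel body_norm" .
  have "indep_rvs M borel V borel (\<lambda>\<omega>. radial_projection (Z \<omega>))"
    unfolding V_def by (rule indep_rvs_compose[OF assms(5,9)]) measurable
  then have "distr M borel (\<lambda>\<omega>. V \<omega> *\<^sub>R radial_projection (Z \<omega>)) = uniform_law"
    using V_law direction by (rule distr_radius_direction[OF assms(5)])
  then show "has_law M (\<lambda>\<omega>. U \<omega> powr (1 / real CARD('n)) *\<^sub>R radial_projection (Z \<omega>))
      (uniform_measure lborel K)"
    by (simp add: has_law_def V_def uniform_law_def distr_id2)
qed

end
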